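(* Let $B_1$ and $B$ be infinite sets with cardinalities $b_1=|B_1|$, $b=|B|$ satisfying $b\ge2^{b_1}$, and let $j:B_1\to B$ be an injection. Let $E_1$ be a regular lim-rim with basis $B_1$ and $E$ a regular lim-rim with basis $B$. Then there exists an embedding of $E_1$ into $E$ over $j$. If moreover $(2^b)^+=2^{2^b}$, then for any two embeddings $f,g$ of $E_1$ into $E$ over $j$ there is an automorphism $\varphi$ of $E$ with $\varphi\circ f=g$.
   Context: $m^+$ denotes the successor cardinal of $m$. For sets $B,E$, a cylinder of $B^E$ is a subset of the form $\{\psi\in B^E:\psi|_J\in R\}$ with $J\subset E$ finite and $R\subset B^J$; the cylinders form a Boolean algebra. A lim-rim over $B$ is a set $E$ together with an ultrafilter $\mathcal L$ in the cylinder Boolean algebra of $B^E$. For $R\subset B^n$ put ${}^*R=\{(e_1,\dots,e_n)\in E^n:\{\psi\in B^E:(\psi_{e_1},\dots,\psi_{e_n})\in R\}\in\mathcal L\}$. The lim-rim is separated if $\{\psi:\psi_e=\psi_{e'}\}\in\mathcal L$ implies $e=e'$. For $\eta:I\to E$, let $\mathcal L_\eta$ be the ultrafilter in the cylinder algebra of $B^I$ consisting of the cylinders $C$ with $\{\psi\in B^E:\psi\circ\eta\in C\}\in\mathcal L$. For a cardinal $m$, $E$ is $m$-exact if for every set $I$ with $|I|<m$, every $i\notin I$, every $\eta:I\to E$, and every ultrafilter $\mathcal U$ in the cylinder algebra of $B^{I\cup\{i\}}$ whose projection to $B^I$ equals $\mathcal L_\eta$, there is an extension $\eta':I\cup\{i\}\to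 E$ of $\eta$ with $\mathcal L_{\eta'}=\mathcal U$. A regular lim-rim with basis $B$ is a separated lim-rim over $B$ of cardinality $2^{2^{|B|}}$ which is $(2^{|B|})^+$-exact. An automorphism of $E$ is a bijection $\varphi:E\to E$ with $\mathcal L_\varphi=\mathcal L$. An embedding of $E_1$ into $E$ over $j$ is an injective map $f:E_1\to E$ such that for all $n$, all $R\subset B_1^n$ and all $e_1,\dots,e_n\in E_1$: $(e_1,\dots,e_n)\in{}^*R$ (computed in $E_1$) if and only if $(f(e_1),\dots,f(e_n))\in{}^*(j(R))$ (computed in $E$), where $j(R)\subset B^n$ is the image of $R$. *)

theory Defs
  imports Main "HOL-Library.FuncSet"
begin

unbundle cardinal_syntax

text \<open>The power \<open>B\<^sup>E\<close> is the set \<open>E \<rightarrow>\<^sub>E B\<close> of extensional functions.\<close>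

definition cylinders :: "'b set \<Rightarrow> 'i set \<Rightarrow> ('i \<Rightarrow> 'b) set set" where
  "cylinders B E =
    {{\<psi> \<in> E \<rightarrow>\<^sub>E B. restrict \<psi> J \<in> R} | J R. J \<subseteq> E \<and> finite J \<and> R \<subseteq> (J \<rightarrow>\<^sub>E B)}"

text \<open>Ultrafilters in a Boolean algebra \<open>A\<close> of subsets of \<open>X\<close>.\<close>

definition ultrafilter_in :: "'x set \<Rightarrow> 'x set set \<Rightarrow> 'x set set \<Rightarrow> bool" where
  "ultrafilter_in X A U \<longleftrightarrow>
    U \<subseteq> A \<and> X \<in> U \<and> {} \<notin> U \<and>
    (\<forall>C\<in>U. \<forall>D\<in>U. C \<inter> D \<in> U) \<and>
    (\<forall>C\<in>U. \<forall>D\<in>A. C \<subseteq> D \<longrightarrow> D \<in> U) \<and>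
    (\<forall>C\<in>A. C \<in> U \<or> X - C \<in> U)"

definition cyl_ultrafilter :: "'b set \<Rightarrow> 'i set \<Rightarrow> ('i \<Rightarrow> 'b) set set \<Rightarrow> bool" where
  "cyl_ultrafilter B E U \<longleftrightarrow> ultrafilter_in (E \<rightarrow>\<^sub>E B) (cylinders B E) U"

definition lim_rim :: "'b set \<Rightarrow> 'e set \<Rightarrow> ('e \<Rightarrow> 'b) set set \<Rightarrow> bool" where
  "lim_rim B E L \<longleftrightarrow> cyl_ultrafilter B E L"

text \<open>Elements of \<open>B\<^sup>n\<close> and \<open>E\<^sup>n\<close> are lists of length \<open>n\<close>; \<open>star B E L n R\<close> is
  \<open>\<^sup>*R\<close> for \<open>R \<subseteq> B\<^sup>n\<close>.\<close>

definition tuples :: "nat \<Rightarrow> 'a set \<Rightarrow> 'a list set" where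
  "tuples n A = {xs. length xs = n \<and> set xs \<subseteq> A}"

definition star ::
  "'b set \<Rightarrow> 'e set \<Rightarrow> ('e \<Rightarrow> 'b) set set \<Rightarrow> nat \<Rightarrow> 'b list set \<Rightarrow> 'e list set" where
  "star B E L n R = {es \<in> tuples n E. {\<psi> \<in> E \<rightarrow>\<^sub>E B. map \<psi> es \<in> R} \<in> L}"

definition separated :: "'b set \<Rightarrow> 'e set \<Rightarrow> ('e \<Rightarrow> 'b) set set \<Rightarrow> bool" where
  "separated B E L \<longleftrightarrow>
    (\<forall>e\<in>E. \<forall>e'\<in>E. {\<psi> \<in> E \<rightarrow>\<^sub>E B. \<psi> e = \<psi> e'} \<in> L \<longrightarrow> e = e')"

text \<open>\<open>induced B E L I \<eta>\<close> is \<open>L\<^sub>\<eta>\<close> for \<open>\<eta> : I \<rightarrow> E\<close>. If \<open>I \<subseteq> E\<close> and \<open>\<eta>\<close> is the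
  inclusion, it is the projection of \<open>L\<close> to \<open>B\<^sup>I\<close>.\<close>

definition induced ::
  "'b set \<Rightarrow> 'e set \<Rightarrow> ('e \<Rightarrow> 'b) set set \<Rightarrow> 'i set \<Rightarrow> ('i \<Rightarrow> 'e) \<Rightarrow> ('i \<Rightarrow> 'b) set set" where
  "induced B E L I \<eta> = {C \<in> cylinders B I. {\<psi> \<in> E \<rightarrow>\<^sub>E B. compose I \<psi> \<eta> \<in> C} \<in> L}"

text \<open>The index sets \<open>I\<close> range over subsets of the type underlying the cardinal \<open>m\<close>.
  This loses no generality: a set of cardinality \<open>< m\<close> has a copy in \<open>Field m\<close>, that
  copy is a proper subset, so there is also room for one further index \<open>i\<close>, and the condition
  is invariant under renaming the indices.\<close>

definition exact :: "'m rel \<Rightarrow> 'b set \<Rightarrow> 'e set \<Rightarrow> ('e \<Rightarrow> 'b) set set \<Rightarrow> bool" where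
  "exact m B E L \<longleftrightarrow>
    (\<forall>(I :: 'm set) i \<eta> U.
       |I| <o m \<and> i \<notin> I \<and> \<eta> \<in> I \<rightarrow> E \<and> cyl_ultrafilter B (insert i I) U \<and>
       induced B (insert i I) U I (\<lambda>k. k) = induced B E L I \<eta>
       \<longrightarrow> (\<exists>\<eta>'. \<eta>' \<in> insert i I \<rightarrow> E \<and> (\<forall>k\<in>I. \<eta>' k = \<eta> k) \<and>
                induced B E L (insert i I) \<eta>' = U))"

definition regular_lim_rim :: "'b set \<Rightarrow> 'e set \<Rightarrow> ('e \<Rightarrow> 'b) set set \<Rightarrow> bool" where
  "regular_lim_rim B E L \<longleftrightarrow>
    lim_rim B E L \<and> separated B E L \<and>
    |E| =o |Pow (Pow B)| \<and> exact (cardSuc |Pow B| ) B E L"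

definition automorphism ::
  "'b set \<Rightarrow> 'e set \<Rightarrow> ('e \<Rightarrow> 'b) set set \<Rightarrow> ('e \<Rightarrow> 'e) \<Rightarrow> bool" where
  "automorphism B E L \<phi> \<longleftrightarrow> bij_betw \<phi> E E \<and> induced B E L E \<phi> = L"

definition embedding_over ::
  "('b1 \<Rightarrow> 'b) \<Rightarrow> 'b1 set \<Rightarrow> 'e1 set \<Rightarrow> ('e1 \<Rightarrow> 'b1) set set \<Rightarrow>
   'b set \<Rightarrow> 'e set \<Rightarrow> ('e \<Rightarrow> 'b) set set \<Rightarrow> ('e1 \<Rightarrow> 'e) \<Rightarrow> bool" where
  "embedding_over j B1 E1 L1 B E L f \<longleftrightarrow>
    f \<in> E1 \<rightarrow> E \<and> inj_on f E1 \<and>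
    (\<forall>n. \<forall>R \<subseteq> tuples n B1. \<forall>es \<in> tuples n E1.
       es \<in> star B1 E1 L1 n R \<longleftrightarrow> map f es \<in> star B E L n (map j ` R))"

end

theory Submission imports Defs begin

text \<open>
  In the language of model theory, a lim-rim over \<open>B\<close> is a structure with one relation for every
  \<open>R \<subseteq> B\<^sup>n\<close>, elementarily equivalent to \<open>B\<close>, and its ultrafilter records the complete types of its
  finite tuples. Exactness for \<open>(2\<^sup>|\<^sup>B\<^sup>|)\<^sup>+\<close> is saturation: types over at most \<open>2\<^sup>|\<^sup>B\<^sup>|\<close> elements are
  realized. The theorem is then universality and homogeneity of saturated structures.

  Everything is phrased with the type of a list of indices (\<open>tuple_type\<close>). Every cylinder is given
  by finitely many indices, so an ultrafilter of cylinders is the same thing as its types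
  (\<open>cylinder_set_eqI\<close>), and restriction and renaming of indices act on types by mapping lists
  (\<open>tuple_type_induced\<close>). A relation between two lim-rims is called elementary if related tuples
  have the same type. This condition is finitary, hence preserved by unions of chains
  (\<open>elementary_Union\<close>), and exactness lets one add a given element to the domain of an elementary
  relation with at most \<open>2\<^sup>|\<^sup>B\<^sup>|\<close> pairs (\<open>elementary_step\<close>).

  Existence: the ultrafilter of \<open>E\<^sub>1\<close> is pushed forward along \<open>j\<close> to a lim-rim over \<open>B\<close> with the same
  underlying set (\<open>base_change\<close>). Since \<open>|E\<^sub>1|\<close> is the double exponential of \<open>|B\<^sub>1|\<close>, the hypothesis
  \<open>2\<^sup>|\<^sup>B\<^sup>1\<^sup>| \<le> |B|\<close> gives \<open>|E\<^sub>1| \<le> 2\<^sup>|\<^sup>B\<^sup>|\<close>, so a maximal elementary relation is the graph of a function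
  defined on all of \<open>E\<^sub>1\<close> (\<open>elementary_total_map\<close>), which is the embedding.

  Uniqueness: an embedding maps \<open>E\<^sub>1\<close> into the extension of \<open>j(B\<^sub>1)\<close>, so the types of image tuples are
  determined by their types in \<open>E\<^sub>1\<close> (\<open>tuple_type_embedding\<close>). Hence the pairs \<open>(f x, g x)\<close> form an
  elementary relation with at most \<open>2\<^sup>|\<^sup>B\<^sup>|\<close> pairs. If \<open>|E|\<close> is the successor of \<open>2\<^sup>|\<^sup>B\<^sup>|\<close>, then \<open>E\<close> has a
  well-order all of whose proper initial segments have at most \<open>2\<^sup>|\<^sup>B\<^sup>|\<close> elements, and running through
  it back and forth keeps all intermediate relations small enough for exactness to apply; their
  union is an automorphism (\<open>back_and_forth\<close>).
\<close>

section \<open>Types of tuples\<close>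

definition tuple_type ::
  "'b set \<Rightarrow> 'i set \<Rightarrow> ('i \<Rightarrow> 'b) set set \<Rightarrow> 'i list \<Rightarrow> 'b list set set" where
  "tuple_type B I U is = {R. {\<psi> \<in> I \<rightarrow>\<^sub>E B. map \<psi> is \<in> R} \<in> U}"

text \<open>
  Describing a cylinder by a list of coordinates instead of a finite set makes the renaming of
  indices a plain \<open>map\<close>, and covers repeated coordinates.
\<close>

lemma cylinders_eq:
  "cylinders B I = {{\<psi> \<in> I \<rightarrow>\<^sub>E B. map \<psi> is \<in> R} | is R. set is \<subseteq> I}"
proof (intro equalityI subsetI)
  fix C assume "C \<in> cylinders B I"
  then obtain J R where J: "J \<subseteq> I" "finite J" and R: "R \<subseteq> J \<rightarrow>\<^sub>E B"
    and C: "C = {\<psi> \<in> I \<rightarrow>\<^sub>E B. restrict \<psi> J \<in> R}"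
    unfolding cylinders_def by blast
  obtain "is" where is_J: "set is = J"
    using finite_list[OF J(2)] by blast
  have "restrict \<psi> J \<in> R \<longleftrightarrow> map \<psi> is \<in> (\<lambda>\<phi>. map \<phi> is) ` R" for \<psi>
  proof
    assume "restrict \<psi> J \<in> R"
    moreover have "map \<psi> is = map (restrict \<psi> J) is"
      using is_J by auto
    ultimately show "map \<psi> is \<in> (\<lambda>\<phi>. map \<phi> is) ` R"
      by blast
  next
    assume "map \<psi> is \<in> (\<lambda>\<phi>. map \<phi> is) ` R"
    then obtain \<phi> where \<phi>: "\<phi> \<in> R" "map \<psi> is = map \<phi> is"
      by blast
    have "restrict \<psi> J = \<phi>"
    proof
      fix x show "restrict \<psi> J x = \<phi> x"
        using \<phi> R is_J by (cases "x \<in> J") (auto simp: PiE_def extensional_def)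
    qed
    then show "restrict \<psi> J \<in> R"
      using \<phi>(1) by simp
  qed
  then have "C = {\<psi> \<in> I \<rightarrow>\<^sub>E B. map \<psi> is \<in> (\<lambda>\<phi>. map \<phi> is) ` R}"
    using C by simp
  then show "C \<in> {{\<psi> \<in> I \<rightarrow>\<^sub>E B. map \<psi> is \<in> R} | is R. set is \<subseteq> I}"
    using is_J J(1) by blast
next
  fix C assume "C \<in> {{\<psi> \<in> I \<rightarrow>\<^sub>E B. map \<psi> is \<in> R} | is R. set is \<subseteq> I}"
  then obtain "is" R where I: "set is \<subseteq> I" and C: "C = {\<psi> \<in> I \<rightarrow>\<^sub>E B. map \<psi> is \<in> R}"
    by blast
  let ?R = "{\<phi> \<in> set is \<rightarrow>\<^sub>E B. map \<phi> is \<in> R}"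
  have "restrict \<psi> (set is) \<in> ?R \<longleftrightarrow> map \<psi> is \<in> R" if "\<psi> \<in> I \<rightarrow>\<^sub>E B" for \<psi>
  proof -
    have "map (restrict \<psi> (set is)) is = map \<psi> is"
      by simp
    moreover have "restrict \<psi> (set is) \<in> set is \<rightarrow>\<^sub>E B"
      using that I by auto
    ultimately show ?thesis
      by (simp del: map_eq_conv)
  qed
  then have "C = {\<psi> \<in> I \<rightarrow>\<^sub>E B. restrict \<psi> (set is) \<in> ?R}"
    using C by blast
  moreover have "?R \<subseteq> set is \<rightarrow>\<^sub>E B"
    by blast
  ultimately show "C \<in> cylinders B I"
    unfolding cylinders_def using I by blast
qed

lemma cylinderI: "set is \<subseteq> I \<Longrightarrow> {\<psi> \<in> I \<rightarrow>\<^sub>E B. map \<psi> is \<in> R} \<in> cylinders B I"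
  unfolding cylinders_eq by blast

lemma cylinderE:
  assumes "C \<in> cylinders B I"
  obtains "is" R where "set is \<subseteq> I" "C = {\<psi> \<in> I \<rightarrow>\<^sub>E B. map \<psi> is \<in> R}"
  using assms unfolding cylinders_eq by blast

lemma cylinders_space: "(I \<rightarrow>\<^sub>E B) \<in> cylinders B I"
  using cylinderI[of "[]" I B UNIV] by simp

lemma cylinders_Compl:
  assumes "C \<in> cylinders B I" shows "(I \<rightarrow>\<^sub>E B) - C \<in> cylinders B I"
proof -
  obtain "is" R where "is": "set is \<subseteq> I" and C: "C = {\<psi> \<in> I \<rightarrow>\<^sub>E B. map \<psi> is \<in> R}"
    using assms by (rule cylinderE)
  have eq: "(I \<rightarrow>\<^sub>E B) - C = {\<psi> \<in> I \<rightarrow>\<^sub>E B. map \<psi> is \<in> - R}"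
    using C by blast
  show ?thesis
    unfolding eq by (rule cylinderI[OF "is"])
qed

lemma cylinders_Int:
  assumes "C \<in> cylinders B I" "D \<in> cylinders B I" shows "C \<inter> D \<in> cylinders B I"
proof -
  obtain "is" R where is_I: "set is \<subseteq> I" and C: "C = {\<psi> \<in> I \<rightarrow>\<^sub>E B. map \<psi> is \<in> R}"
    using assms(1) by (rule cylinderE)
  obtain js S where js_I: "set js \<subseteq> I" and D: "D = {\<psi> \<in> I \<rightarrow>\<^sub>E B. map \<psi> js \<in> S}"
    using assms(2) by (rule cylinderE)
  let ?T = "{xs. take (length is) xs \<in> R \<and> drop (length is) xs \<in> S}"
  have eq: "C \<inter> D = {\<psi> \<in> I \<rightarrow>\<^sub>E B. map \<psi> (is @ js) \<in> ?T}"
    using C D by auto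
  have "set (is @ js) \<subseteq> I"
    using is_I js_I by simp
  then show ?thesis
    unfolding eq by (rule cylinderI)
qed

lemma cylinder_set_eqI:
  assumes "U \<subseteq> cylinders B I" "V \<subseteq> cylinders B I"
    and "\<And>is. set is \<subseteq> I \<Longrightarrow> tuple_type B I U is = tuple_type B I V is"
  shows "U = V"
proof -
  have "C \<in> U \<longleftrightarrow> C \<in> V" if cyl: "C \<in> cylinders B I" for C
  proof -
    obtain "is" R where "set is \<subseteq> I" and C: "C = {\<psi> \<in> I \<rightarrow>\<^sub>E B. map \<psi> is \<in> R}"
      using cyl by (rule cylinderE)
    then have "R \<in> tuple_type B I U is \<longleftrightarrow> R \<in> tuple_type B I V is"
      using assms(3) by simp
    then show ?thesis
      unfolding tuple_type_def C by simp
  qed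
  then show ?thesis
    using assms(1,2) by blast
qed

lemma tuple_type_Int:
  assumes U: "cyl_ultrafilter B I U" and "is": "set is \<subseteq> I"
    and R: "R \<in> tuple_type B I U is"
  shows "R \<inter> S \<in> tuple_type B I U is \<longleftrightarrow> S \<in> tuple_type B I U is"
proof -
  let ?c = "\<lambda>R. {\<psi> \<in> I \<rightarrow>\<^sub>E B. map \<psi> is \<in> R}"
  have Int: "?c (R \<inter> S) = ?c R \<inter> ?c S"
    by blast
  have R_U: "?c R \<in> U"
    using R by (simp add: tuple_type_def)
  have closed: "\<And>C D. C \<in> U \<Longrightarrow> D \<in> U \<Longrightarrow> C \<inter> D \<in> U"
    and up: "\<And>C D. C \<in> U \<Longrightarrow> D \<in> cylinders B I \<Longrightarrow> C \<subseteq> D \<Longrightarrow> D \<in> U"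
    using U unfolding cyl_ultrafilter_def ultrafilter_in_def by blast+
  have "?c (R \<inter> S) \<in> U \<longleftrightarrow> ?c S \<in> U"
  proof
    show "?c (R \<inter> S) \<in> U \<Longrightarrow> ?c S \<in> U"
      by (rule up[OF _ cylinderI[OF "is"]]) auto
    show "?c S \<in> U \<Longrightarrow> ?c (R \<inter> S) \<in> U"
      unfolding Int by (rule closed[OF R_U])
  qed
  then show ?thesis
    by (simp add: tuple_type_def)
qed

lemma tuple_type_total:
  assumes U: "cyl_ultrafilter B I U" and R: "\<And>\<psi>. \<psi> \<in> I \<rightarrow>\<^sub>E B \<Longrightarrow> map \<psi> is \<in> R"
  shows "R \<in> tuple_type B I U is"
proof -
  have "{\<psi> \<in> I \<rightarrow>\<^sub>E B. map \<psi> is \<in> R} = I \<rightarrow>\<^sub>E B"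
    using R by blast
  then show ?thesis
    using U unfolding tuple_type_def cyl_ultrafilter_def ultrafilter_in_def by simp
qed

lemma tuple_type_Nil:
  assumes "cyl_ultrafilter B I U" shows "tuple_type B I U [] = {R. [] \<in> R}"
proof -
  have "(I \<rightarrow>\<^sub>E B) \<in> U" "{} \<notin> U"
    using assms by (simp_all add: cyl_ultrafilter_def ultrafilter_in_def)
  then have "{\<psi> \<in> I \<rightarrow>\<^sub>E B. map \<psi> [] \<in> R} \<in> U \<longleftrightarrow> [] \<in> R" for R
    by (cases "[] \<in> R") simp_all
  then show ?thesis
    by (simp add: tuple_type_def)
qed

text \<open>Membership of this relation in the type of a pair is what separatedness speaks about.\<close>

definition diagonal :: "'b list set" where
  "diagonal = {[x, x] | x. True}"

lemma diagonal_in_tuple_type_iff: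
  "diagonal \<in> tuple_type B I U [x, y] \<longleftrightarrow> {\<psi> \<in> I \<rightarrow>\<^sub>E B. \<psi> x = \<psi> y} \<in> U"
proof -
  have "map \<psi> [x, y] \<in> diagonal \<longleftrightarrow> \<psi> x = \<psi> y" for \<psi> :: "'b \<Rightarrow> 'a"
    by (auto simp: diagonal_def)
  then show ?thesis
    by (simp only: tuple_type_def mem_Collect_eq)
qed

lemma separatedD:
  assumes "separated B E L" "x \<in> E" "y \<in> E" "diagonal \<in> tuple_type B E L [x, y]"
  shows "x = y"
  using assms unfolding separated_def diagonal_in_tuple_type_iff by blast

section \<open>Images of ultrafilters\<close>

text \<open>
  Common source of the two changes of an ultrafilter used below: renaming the indices and changing
  the basis. Both are induced by maps \<open>\<Phi>\<close> between power sets that pull cylinders back to cylinders.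
\<close>

lemma cyl_ultrafilter_image:
  assumes U: "cyl_ultrafilter B I U"
    and maps: "\<And>\<psi>. \<psi> \<in> I \<rightarrow>\<^sub>E B \<Longrightarrow> \<Phi> \<psi> \<in> K \<rightarrow>\<^sub>E B'"
    and cyl: "\<And>C. C \<in> cylinders B' K \<Longrightarrow> {\<psi> \<in> I \<rightarrow>\<^sub>E B. \<Phi> \<psi> \<in> C} \<in> cylinders B I"
  shows "cyl_ultrafilter B' K {C \<in> cylinders B' K. {\<psi> \<in> I \<rightarrow>\<^sub>E B. \<Phi> \<psi> \<in> C} \<in> U}"
proof -
  let ?p = "\<lambda>C. {\<psi> \<in> I \<rightarrow>\<^sub>E B. \<Phi> \<psi> \<in> C}"
  have space: "?p (K \<rightarrow>\<^sub>E B') = I \<rightarrow>\<^sub>E B"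
    using maps by blast
  let ?V = "{C \<in> cylinders B' K. ?p C \<in> U}"
  have U_Int: "\<And>C D. C \<in> U \<Longrightarrow> D \<in> U \<Longrightarrow> C \<inter> D \<in> U"
    and U_up: "\<And>C D. C \<in> U \<Longrightarrow> D \<in> cylinders B I \<Longrightarrow> C \<subseteq> D \<Longrightarrow> D \<in> U"
    and U_Compl: "\<And>C. C \<in> cylinders B I \<Longrightarrow> C \<in> U \<or> (I \<rightarrow>\<^sub>E B) - C \<in> U"
    and U_space: "(I \<rightarrow>\<^sub>E B) \<in> U" and U_empty: "{} \<notin> U"
    using U unfolding cyl_ultrafilter_def ultrafilter_in_def by blast+
  show ?thesis
    unfolding cyl_ultrafilter_def ultrafilter_in_def
  proof (intro conjI ballI impI)
    show "?V \<subseteq> cylinders B' K"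
      by blast
    show "(K \<rightarrow>\<^sub>E B') \<in> ?V"
      using cylinders_space[of K B'] space U_space by simp
    show "{} \<notin> ?V"
      using U_empty by simp
  next
    fix C D assume "C \<in> ?V" "D \<in> ?V"
    moreover have "?p (C \<inter> D) = ?p C \<inter> ?p D"
      by blast
    ultimately show "C \<inter> D \<in> ?V"
      using cylinders_Int[of C B' K D] U_Int[of "?p C" "?p D"] by simp
  next
    fix C D assume C: "C \<in> ?V" and D: "D \<in> cylinders B' K" and "C \<subseteq> D"
    then have "?p C \<subseteq> ?p D"
      by blast
    with C have "?p D \<in> U"
      using U_up[OF _ cyl[OF D], of "?p C"] by simp
    with D show "D \<in> ?V"
      by simp
  next
    fix C assume C: "C \<in> cylinders B' K"
    have "?p ((K \<rightarrow>\<^sub>E B') - C) = (I \<rightarrow>\<^sub>E B) - ?p C"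
      using maps by blast
    then show "C \<in> ?V \<or> (K \<rightarrow>\<^sub>E B') - C \<in> ?V"
      using U_Compl[OF cyl[OF C]] C cylinders_Compl[OF C] by simp
  qed
qed

lemma compose_vimage_cylinder:
  fixes \<eta> :: "'k \<Rightarrow> 'i" and B :: "'b set"
  assumes "\<eta> \<in> K \<rightarrow> I" "set ks \<subseteq> K"
  shows "{\<psi> \<in> I \<rightarrow>\<^sub>E B. compose K \<psi> \<eta> \<in> {\<phi> \<in> K \<rightarrow>\<^sub>E B. map \<phi> ks \<in> R}} =
    {\<psi> \<in> I \<rightarrow>\<^sub>E B. map \<psi> (map \<eta> ks) \<in> R}"
proof -
  have "map (compose K \<psi> \<eta>) ks = map \<psi> (map \<eta> ks)" for \<psi> :: "'i \<Rightarrow> 'b"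
    using assms(2) by (simp add: compose_def subset_iff)
  moreover have "compose K \<psi> \<eta> \<in> K \<rightarrow>\<^sub>E B" if "\<psi> \<in> I \<rightarrow>\<^sub>E B" for \<psi>
    using that assms(1) by (auto simp: compose_def)
  ultimately show ?thesis
    by (intro Collect_cong conj_cong refl) (simp only: mem_Collect_eq simp_thms)
qed

lemma tuple_type_induced:
  assumes "\<eta> \<in> K \<rightarrow> I" "set ks \<subseteq> K"
  shows "tuple_type B K (induced B I U K \<eta>) ks = tuple_type B I U (map \<eta> ks)"
proof -
  have "C \<in> induced B I U K \<eta> \<longleftrightarrow> {\<psi> \<in> I \<rightarrow>\<^sub>E B. compose K \<psi> \<eta> \<in> C} \<in> U"
    if "C \<in> cylinders B K" for C
    using that by (simp add: induced_def)
  from this[OF cylinderI[OF assms(2)]] show ?thesis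
    unfolding tuple_type_def compose_vimage_cylinder[OF assms] by blast
qed

lemma cyl_ultrafilter_induced:
  assumes "cyl_ultrafilter B I U" and \<eta>: "\<eta> \<in> K \<rightarrow> I"
  shows "cyl_ultrafilter B K (induced B I U K \<eta>)"
  unfolding induced_def
proof (rule cyl_ultrafilter_image[OF assms(1)])
  show "compose K \<psi> \<eta> \<in> K \<rightarrow>\<^sub>E B" if "\<psi> \<in> I \<rightarrow>\<^sub>E B" for \<psi>
    using that \<eta> by (auto simp: compose_def)
next
  fix C assume "C \<in> cylinders B K"
  then obtain ks R where ks: "set ks \<subseteq> K" and C: "C = {\<psi> \<in> K \<rightarrow>\<^sub>E B. map \<psi> ks \<in> R}"
    by (rule cylinderE)
  have "set (map \<eta> ks) \<subseteq> I"
    using ks \<eta> by auto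
  then show "{\<psi> \<in> I \<rightarrow>\<^sub>E B. compose K \<psi> \<eta> \<in> C} \<in> cylinders B I"
    unfolding C compose_vimage_cylinder[OF \<eta> ks] by (rule cylinderI)
qed

lemma induced_eqI:
  assumes "\<eta> \<in> K \<rightarrow> I" "\<theta> \<in> K \<rightarrow> I'"
    and "\<And>ks. set ks \<subseteq> K \<Longrightarrow> tuple_type B I U (map \<eta> ks) = tuple_type B I' U' (map \<theta> ks)"
  shows "induced B I U K \<eta> = induced B I' U' K \<theta>"
proof (rule cylinder_set_eqI)
  show "induced B I U K \<eta> \<subseteq> cylinders B K" "induced B I' U' K \<theta> \<subseteq> cylinders B K"
    by (auto simp: induced_def)
qed (simp add: tuple_type_induced assms)

text \<open>
  Replaces the basis and keeps the underlying set \<open>I\<close>, so that an embedding over \<open>j\<close> becomes a map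
  between two lim-rims over the same basis that preserves types.
\<close>

definition base_change ::
  "('b1 \<Rightarrow> 'b) \<Rightarrow> 'b1 set \<Rightarrow> 'b set \<Rightarrow> 'i set \<Rightarrow> ('i \<Rightarrow> 'b1) set set \<Rightarrow> ('i \<Rightarrow> 'b) set set" where
  "base_change j B1 B I U =
    {C \<in> cylinders B I. {\<psi> \<in> I \<rightarrow>\<^sub>E B1. compose I j \<psi> \<in> C} \<in> U}"

lemma base_change_vimage_cylinder:
  assumes "j \<in> B1 \<rightarrow> B" "set is \<subseteq> I"
  shows "{\<psi> \<in> I \<rightarrow>\<^sub>E B1. compose I j \<psi> \<in> {\<phi> \<in> I \<rightarrow>\<^sub>E B. map \<phi> is \<in> R}} =
    {\<psi> \<in> I \<rightarrow>\<^sub>E B1. map \<psi> is \<in> {xs. map j xs \<in> R}}"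
proof -
  have "map (compose I j \<psi>) is = map j (map \<psi> is)" for \<psi>
    using assms(2) by (simp add: compose_def subset_iff)
  moreover have "compose I j \<psi> \<in> I \<rightarrow>\<^sub>E B" if "\<psi> \<in> I \<rightarrow>\<^sub>E B1" for \<psi>
    using that assms(1) by (auto simp: compose_def)
  ultimately show ?thesis
    by (intro Collect_cong conj_cong refl) (simp only: mem_Collect_eq simp_thms)
qed

lemma tuple_type_base_change:
  assumes "j \<in> B1 \<rightarrow> B" "set is \<subseteq> I"
  shows "R \<in> tuple_type B I (base_change j B1 B I U) is \<longleftrightarrow>
    {xs. map j xs \<in> R} \<in> tuple_type B1 I U is"
proof -
  have "C \<in> base_change j B1 B I U \<longleftrightarrow> {\<psi> \<in> I \<rightarrow>\<^sub>E B1. compose I j \<psi> \<in> C} \<in> U"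
    if "C \<in> cylinders B I" for C
    using that by (simp add: base_change_def)
  from this[OF cylinderI[OF assms(2)]] show ?thesis
    unfolding tuple_type_def base_change_vimage_cylinder[OF assms] by blast
qed

lemma cyl_ultrafilter_base_change:
  assumes "cyl_ultrafilter B1 I U" and j: "j \<in> B1 \<rightarrow> B"
  shows "cyl_ultrafilter B I (base_change j B1 B I U)"
  unfolding base_change_def
proof (rule cyl_ultrafilter_image[OF assms(1)])
  show "compose I j \<psi> \<in> I \<rightarrow>\<^sub>E B" if "\<psi> \<in> I \<rightarrow>\<^sub>E B1" for \<psi>
    using that j by (auto simp: compose_def)
next
  fix C assume "C \<in> cylinders B I"
  then obtain "is" R where "is": "set is \<subseteq> I" and C: "C = {\<psi> \<in> I \<rightarrow>\<^sub>E B. map \<psi> is \<in> R}"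
    by (rule cylinderE)
  show "{\<psi> \<in> I \<rightarrow>\<^sub>E B1. compose I j \<psi> \<in> C} \<in> cylinders B1 I"
    unfolding C base_change_vimage_cylinder[OF j "is"] by (rule cylinderI[OF "is"])
qed

section \<open>Exactness with arbitrary index sets\<close>

lemma Un_ordLeq_infinite:
  assumes "infinite A" "|X| \<le>o |A|" "|Y| \<le>o |A|" shows "|X \<union> Y| \<le>o |A|"
  by (rule card_of_Un_ordLeq_infinite_Field) (simp_all add: assms card_of_card_order_on Field_card_of)

lemma insert_ordLeq_infinite:
  assumes "infinite A" "|X| \<le>o |A|" shows "|insert x X| \<le>o |A|"
proof -
  have "|{x}| \<le>o |A|"
    using assms(1) by (intro card_of_singl_ordLeq) auto
  then have "|{x} \<union> X| \<le>o |A|"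
    using assms by (intro Un_ordLeq_infinite)
  then show ?thesis
    by simp
qed

text \<open>
  The definition of exactness quantifies over index sets in one fixed type only. A set \<open>insert i I\<close>
  of any type with \<open>|I| \<le> 2\<^sup>|\<^sup>B\<^sup>|\<close> injects into that type, and the ultrafilter is transported along
  the inverse \<open>g\<close> of such an injection \<open>h\<close>.
\<close>

lemma exact_extend:
  fixes I :: "'i set" and B :: "'b set"
  assumes "infinite B" and ex: "exact (cardSuc |Pow B| ) B E L"
    and I: "|I| \<le>o |Pow B|" "i \<notin> I" and \<eta>: "\<eta> \<in> I \<rightarrow> E"
    and U: "cyl_ultrafilter B (insert i I) U"
    and proj: "\<And>is. set is \<subseteq> I \<Longrightarrow>
      tuple_type B (insert i I) U is = tuple_type B E L (map \<eta> is)"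
  obtains e where "e \<in> E"
    and "\<And>is. set is \<subseteq> insert i I \<Longrightarrow>
      tuple_type B (insert i I) U is = tuple_type B E L (map (\<eta>(i := e)) is)"
proof -
  let ?m = "cardSuc |Pow B|"
  let ?K = "insert i I"
  have inf: "infinite (Pow B)"
    using \<open>infinite B\<close> by simp
  have m: "|Pow B| <o ?m" "Card_order ?m"
    by (simp_all add: cardSuc_greater cardSuc_Card_order card_of_Card_order)
  have "|?K| \<le>o |Pow B|"
    by (rule insert_ordLeq_infinite[OF inf I(1)])
  then have "|?K| \<le>o |Field ?m|"
    using m card_of_Field_ordIso[OF m(2)]
    by (meson ordIso_symmetric ordLeq_ordIso_trans ordLeq_transitive ordLess_imp_ordLeq)
  then obtain h :: "'i \<Rightarrow> 'b set set" where h: "inj_on h ?K"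
    using card_of_ordLeq by metis
  define g where "g = inv_into ?K h"
  have gh: "g (h k) = k" if "k \<in> ?K" for k
    using h that unfolding g_def by simp
  have g: "g \<in> insert (h i) (h ` I) \<rightarrow> ?K" "g \<in> h ` I \<rightarrow> I"
    using gh by auto
  define U' where "U' = induced B ?K U (insert (h i) (h ` I)) g"
  have U': "cyl_ultrafilter B (insert (h i) (h ` I)) U'"
    unfolding U'_def by (rule cyl_ultrafilter_induced[OF U g(1)])
  have tt_U': "tuple_type B (insert (h i) (h ` I)) U' ks = tuple_type B ?K U (map g ks)"
    if "set ks \<subseteq> insert (h i) (h ` I)" for ks
    unfolding U'_def by (rule tuple_type_induced[OF g(1) that])
  have \<eta>g: "\<eta> \<circ> g \<in> h ` I \<rightarrow> E"
    using \<eta> g(2) by (intro funcsetI) (metis comp_apply funcset_mem)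
  have proj': "induced B (insert (h i) (h ` I)) U' (h ` I) (\<lambda>k. k) = induced B E L (h ` I) (\<eta> \<circ> g)"
  proof (rule induced_eqI)
    fix ks assume ks: "set ks \<subseteq> h ` I"
    have "set (map g ks) \<subseteq> I"
      using ks g(2) by auto
    then have "tuple_type B ?K U (map g ks) = tuple_type B E L (map \<eta> (map g ks))"
      by (rule proj)
    then show "tuple_type B (insert (h i) (h ` I)) U' (map (\<lambda>k. k) ks) =
        tuple_type B E L (map (\<eta> \<circ> g) ks)"
      using tt_U'[of ks] ks by auto
  qed (use \<eta>g in auto)
  have "|h ` I| <o ?m"
    using card_of_image[of h I] I(1) m(1) by (meson ordLeq_ordLess_trans ordLeq_transitive)
  moreover have "h i \<notin> h ` I"
    using h I(2) by (auto simp: inj_on_def)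
  ultimately obtain \<theta> where \<theta>: "\<theta> \<in> insert (h i) (h ` I) \<rightarrow> E" "\<forall>k\<in>h ` I. \<theta> k = (\<eta> \<circ> g) k"
    "induced B E L (insert (h i) (h ` I)) \<theta> = U'"
    using ex \<eta>g U' proj' unfolding exact_def by blast
  show thesis
  proof (rule that)
    show "\<theta> (h i) \<in> E"
      using \<theta>(1) by auto
    fix "is" assume "is": "set is \<subseteq> ?K"
    have set_h: "set (map h is) \<subseteq> insert (h i) (h ` I)"
      using "is" by auto
    have "map g (map h is) = is"
      using "is" gh by (simp add: map_idI subset_iff)
    then have "tuple_type B ?K U is = tuple_type B (insert (h i) (h ` I)) U' (map h is)"
      using tt_U'[OF set_h] by simp
    also have "\<dots> = tuple_type B E L (map \<theta> (map h is))"
      using tuple_type_induced[OF \<theta>(1) set_h, of B L] \<theta>(3) by simp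
    also have "map \<theta> (map h is) = map (\<eta>(i := \<theta> (h i))) is"
      using "is" \<theta>(2) gh by auto
    finally show "tuple_type B ?K U is = tuple_type B E L (map (\<eta>(i := \<theta> (h i))) is)" .
  qed
qed

section \<open>Elementary relations\<close>

definition elementary ::
  "'b set \<Rightarrow> 'e1 set \<Rightarrow> ('e1 \<Rightarrow> 'b) set set \<Rightarrow> 'e2 set \<Rightarrow> ('e2 \<Rightarrow> 'b) set set \<Rightarrow>
   ('e1 \<times> 'e2) set \<Rightarrow> bool" where
  "elementary B E1 L1 E2 L2 Q \<longleftrightarrow> Q \<subseteq> E1 \<times> E2 \<and>
    (\<forall>ps. set ps \<subseteq> Q \<longrightarrow>
      tuple_type B E1 L1 (map fst ps) = tuple_type B E2 L2 (map snd ps))"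

lemma elementaryD:
  assumes "elementary B E1 L1 E2 L2 Q" "set ps \<subseteq> Q"
  shows "tuple_type B E1 L1 (map fst ps) = tuple_type B E2 L2 (map snd ps)"
  using assms by (simp add: elementary_def)

lemma elementary_converse:
  assumes "elementary B E1 L1 E2 L2 Q" shows "elementary B E2 L2 E1 L1 (Q\<inverse>)"
  unfolding elementary_def
proof (intro conjI allI impI)
  show "Q\<inverse> \<subseteq> E2 \<times> E1"
    using assms by (auto simp: elementary_def)
  fix ps assume "set ps \<subseteq> Q\<inverse>"
  then have "set (map prod.swap ps) \<subseteq> Q"
    by auto
  from elementaryD[OF assms this]
  show "tuple_type B E2 L2 (map fst ps) = tuple_type B E1 L1 (map snd ps)"
    by (simp add: comp_def)
qed

lemma elementary_empty:
  assumes "cyl_ultrafilter B E1 L1" "cyl_ultrafilter B E2 L2"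
  shows "elementary B E1 L1 E2 L2 {}"
  using assms by (simp add: elementary_def tuple_type_Nil)

text \<open>A list of pairs from the union of a chain already lies in one member of the chain.\<close>

lemma elementary_Union:
  assumes "\<And>Q. Q \<in> \<C> \<Longrightarrow> elementary B E1 L1 E2 L2 Q" and "\<C> \<noteq> {}"
    and chain: "\<And>Q Q'. Q \<in> \<C> \<Longrightarrow> Q' \<in> \<C> \<Longrightarrow> Q \<subseteq> Q' \<or> Q' \<subseteq> Q"
  shows "elementary B E1 L1 E2 L2 (\<Union>\<C>)"
  unfolding elementary_def
proof (intro conjI allI impI)
  show "\<Union>\<C> \<subseteq> E1 \<times> E2"
    using assms(1) unfolding elementary_def by blast
  fix ps assume "set ps \<subseteq> \<Union>\<C>"
  moreover have "subset.chain UNIV \<C>"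
    using chain by (auto simp: subset_chain_def)
  ultimately obtain Q where "Q \<in> \<C>" "set ps \<subseteq> Q"
    using finite_subset_Union_chain[OF finite_set _ \<open>\<C> \<noteq> {}\<close>] by blast
  then show "tuple_type B E1 L1 (map fst ps) = tuple_type B E2 L2 (map snd ps)"
    using assms(1) elementaryD by blast
qed

text \<open>The equality \<open>x = x\<close> is part of the type of \<open>(x, x)\<close>, hence of that of \<open>(y, y')\<close>.\<close>

lemma elementary_functional:
  assumes Q: "elementary B E1 L1 E2 L2 Q" and L1: "cyl_ultrafilter B E1 L1"
    and sep: "separated B E2 L2" and xy: "(x, y) \<in> Q" "(x, y') \<in> Q"
  shows "y = y'"
proof (rule separatedD[OF sep])
  show "y \<in> E2" "y' \<in> E2"
    using Q xy by (auto simp: elementary_def)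
  have "diagonal \<in> tuple_type B E1 L1 [x, x]"
    by (rule tuple_type_total[OF L1]) (simp add: diagonal_def)
  then show "diagonal \<in> tuple_type B E2 L2 [y, y']"
    using elementaryD[OF Q, of "[(x, y), (x, y')]"] xy by simp
qed

text \<open>
  The relation \<open>Q\<close> itself serves as index set, with \<open>None\<close> as the additional index. Through the first
  components it carries an ultrafilter that is induced from \<open>E1\<close> and includes the type of \<open>x\<close>;
  because \<open>Q\<close> is elementary, its projection to the old indices is the ultrafilter induced from \<open>E2\<close>
  through the second components, so exactness of \<open>E2\<close> yields a partner for \<open>x\<close>.
\<close>

lemma elementary_step:
  fixes E1 :: "'e1 set" and E2 :: "'e2 set"
  assumes "infinite B" and ex: "exact (cardSuc |Pow B| ) B E2 L2"
    and L1: "cyl_ultrafilter B E1 L1"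
    and Q: "elementary B E1 L1 E2 L2 Q" "|Q| \<le>o |Pow B|" and x: "x \<in> E1"
  obtains y where "y \<in> E2" "elementary B E1 L1 E2 L2 (insert (x, y) Q)"
proof -
  have QE: "Q \<subseteq> E1 \<times> E2"
    using Q(1) by (simp add: elementary_def)
  define I where "I = Some ` Q"
  define \<alpha> :: "('e1 \<times> 'e2) option \<Rightarrow> 'e1" where "\<alpha> = case_option x fst"
  define \<eta> :: "('e1 \<times> 'e2) option \<Rightarrow> 'e2" where "\<eta> = snd \<circ> the"
  have \<alpha>: "\<alpha> \<in> insert None I \<rightarrow> E1" and \<eta>: "\<eta> \<in> I \<rightarrow> E2"
    using QE x unfolding \<alpha>_def \<eta>_def I_def by auto
  define U where "U = induced B E1 L1 (insert None I) \<alpha>"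
  have tt_U: "tuple_type B (insert None I) U ks = tuple_type B E1 L1 (map \<alpha> ks)"
    if "set ks \<subseteq> insert None I" for ks
    unfolding U_def by (rule tuple_type_induced[OF \<alpha> that])
  have "tuple_type B (insert None I) U ks = tuple_type B E2 L2 (map \<eta> ks)"
    if ks: "set ks \<subseteq> I" for ks
  proof -
    have "set (map the ks) \<subseteq> Q"
      using ks by (auto simp: I_def)
    from elementaryD[OF Q(1) this]
    have "tuple_type B E1 L1 (map (fst \<circ> the) ks) = tuple_type B E2 L2 (map \<eta> ks)"
      by (simp add: \<eta>_def comp_def)
    moreover have "map (fst \<circ> the) ks = map \<alpha> ks"
      using ks by (auto simp: I_def \<alpha>_def)
    ultimately show ?thesis
      using tt_U[of ks] ks by auto
  qed
  moreover have "|I| \<le>o |Pow B|"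
    using card_of_image[of Some Q] Q(2) ordLeq_transitive unfolding I_def by blast
  moreover have "None \<notin> I"
    by (auto simp: I_def)
  moreover have "cyl_ultrafilter B (insert None I) U"
    unfolding U_def by (rule cyl_ultrafilter_induced[OF L1 \<alpha>])
  ultimately obtain y where y: "y \<in> E2" and tt_y: "\<And>ks. set ks \<subseteq> insert None I \<Longrightarrow>
      tuple_type B (insert None I) U ks = tuple_type B E2 L2 (map (\<eta>(None := y)) ks)"
    using exact_extend[OF \<open>infinite B\<close> ex _ _ \<eta>] by blast
  have "tuple_type B E1 L1 (map fst ps) = tuple_type B E2 L2 (map snd ps)"
    if ps: "set ps \<subseteq> insert (x, y) Q" for ps
  proof -
    define ks where "ks = map (\<lambda>p. if p \<in> Q then Some p else None) ps"
    have ks: "set ks \<subseteq> insert None I"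
      unfolding ks_def I_def by auto
    have "map fst ps = map \<alpha> ks" "map snd ps = map (\<eta>(None := y)) ks"
      using ps unfolding ks_def \<alpha>_def \<eta>_def by auto
    then show ?thesis
      using tt_U[OF ks] tt_y[OF ks] by simp
  qed
  then have "elementary B E1 L1 E2 L2 (insert (x, y) Q)"
    using QE x y by (simp add: elementary_def)
  with y that show thesis
    by blast
qed

text \<open>
  A maximal elementary relation is a function because \<open>E2\<close> is separated, so it has at most \<open>|E1|\<close>
  pairs; this bound is what allows one more step if its domain were not all of \<open>E1\<close>.
\<close>

lemma elementary_total_map:
  assumes "infinite B" and L1: "cyl_ultrafilter B E1 L1"
    and L2: "cyl_ultrafilter B E2 L2" and sep: "separated B E2 L2"
    and ex: "exact (cardSuc |Pow B| ) B E2 L2" and E1: "|E1| \<le>o |Pow B|"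
  obtains f where "f \<in> E1 \<rightarrow> E2"
    and "\<And>es. set es \<subseteq> E1 \<Longrightarrow> tuple_type B E1 L1 es = tuple_type B E2 L2 (map f es)"
proof -
  let ?A = "{Q. elementary B E1 L1 E2 L2 Q}"
  have "\<exists>Q\<in>?A. \<forall>X\<in>?A. Q \<subseteq> X \<longrightarrow> X = Q"
  proof (rule subset_Zorn_nonempty)
    show "?A \<noteq> {}"
      using elementary_empty[OF L1 L2] by blast
    fix \<C> assume ne: "\<C> \<noteq> {}" and chain: "subset.chain ?A \<C>"
    have "elementary B E1 L1 E2 L2 (\<Union>\<C>)"
    proof (rule elementary_Union[OF _ ne])
      show "elementary B E1 L1 E2 L2 Q" if "Q \<in> \<C>" for Q
        using chain that by (auto simp: subset_chain_def)
      show "Q \<subseteq> Q' \<or> Q' \<subseteq> Q" if "Q \<in> \<C>" "Q' \<in> \<C>" for Q Q'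
        using chain that by (simp add: subset_chain_def)
    qed
    then show "\<Union>\<C> \<in> ?A"
      by simp
  qed
  then obtain Q where Q: "elementary B E1 L1 E2 L2 Q"
    and max: "\<And>X. elementary B E1 L1 E2 L2 X \<Longrightarrow> Q \<subseteq> X \<Longrightarrow> X = Q"
    by blast
  have QE: "Q \<subseteq> E1 \<times> E2"
    using Q by (simp add: elementary_def)
  have "inj_on fst Q"
    using elementary_functional[OF Q L1 sep] by (force simp: inj_on_def)
  moreover have "fst ` Q \<subseteq> E1"
    using QE by auto
  ultimately have "|Q| \<le>o |E1|"
    using card_of_ordLeq by blast
  then have Q_card: "|Q| \<le>o |Pow B|"
    using E1 ordLeq_transitive by blast
  have "\<exists>y. (x, y) \<in> Q" if x: "x \<in> E1" for x
  proof -
    obtain y where "elementary B E1 L1 E2 L2 (insert (x, y) Q)"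
      using elementary_step[OF \<open>infinite B\<close> ex L1 Q Q_card x] by blast
    from max[OF this] show ?thesis
      by blast
  qed
  then obtain f where f: "\<And>x. x \<in> E1 \<Longrightarrow> (x, f x) \<in> Q"
    by metis
  show thesis
  proof (rule that)
    show "f \<in> E1 \<rightarrow> E2"
      using f QE by auto
    fix es assume "set es \<subseteq> E1"
    then have "set (map (\<lambda>x. (x, f x)) es) \<subseteq> Q"
      using f by auto
    from elementaryD[OF Q this]
    show "tuple_type B E1 L1 es = tuple_type B E2 L2 (map f es)"
      by (simp add: comp_def)
  qed
qed

section \<open>Back and forth\<close>

text \<open>One round of back and forth: \<open>e\<close> is added to the domain, then, via the converse, to the range.\<close>

lemma elementary_step_both:
  assumes "infinite B" and reg: "regular_lim_rim B E L"
    and Q: "elementary B E L E L Q" "|Q| \<le>o |Pow B|" and e: "e \<in> E"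
  shows "\<exists>Q'. elementary B E L E L Q' \<and> Q \<subseteq> Q' \<and> |Q'| \<le>o |Pow B| \<and>
    e \<in> Domain Q' \<and> e \<in> Range Q'"
proof -
  have ex: "exact (cardSuc |Pow B| ) B E L" and L: "cyl_ultrafilter B E L"
    using reg by (auto simp: regular_lim_rim_def lim_rim_def)
  have inf: "infinite (Pow B)"
    using \<open>infinite B\<close> by simp
  obtain y where y: "elementary B E L E L (insert (e, y) Q)"
    using elementary_step[OF \<open>infinite B\<close> ex L Q e] by blast
  let ?Q = "insert (e, y) Q"
  have "?Q\<inverse> = prod.swap ` ?Q"
    by force
  then have "|?Q\<inverse>| \<le>o |?Q|"
    using card_of_image[of prod.swap ?Q] by (simp only:)
  then have "|?Q\<inverse>| \<le>o |Pow B|"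
    using insert_ordLeq_infinite[OF inf Q(2)] ordLeq_transitive by blast
  then obtain x where "elementary B E L E L (insert (e, x) (?Q\<inverse>))"
    using elementary_step[OF \<open>infinite B\<close> ex L elementary_converse[OF y] _ e] by blast
  then have "elementary B E L E L ((insert (e, x) (?Q\<inverse>))\<inverse>)"
    by (rule elementary_converse)
  moreover have "(insert (e, x) (?Q\<inverse>))\<inverse> = insert (x, e) ?Q"
    by auto
  ultimately have "elementary B E L E L (insert (x, e) ?Q)"
    by simp
  then show ?thesis
    using insert_ordLeq_infinite[OF inf insert_ordLeq_infinite[OF inf Q(2)]] by (intro exI[of _ "insert (x, e) ?Q"]) blast
qed

lemma automorphism_of_elementary:
  assumes L: "cyl_ultrafilter B E L" and sep: "separated B E L"
    and P: "elementary B E L E L P" and dom: "E \<subseteq> Domain P" and ran: "E \<subseteq> Range P"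
  obtains \<phi> where "automorphism B E L \<phi>" "\<And>x y. (x, y) \<in> P \<Longrightarrow> \<phi> x = y"
proof -
  have PE: "P \<subseteq> E \<times> E"
    using P by (simp add: elementary_def)
  have "\<forall>x\<in>E. \<exists>y. (x, y) \<in> P"
    using dom by blast
  then obtain \<phi> where \<phi>: "\<And>x. x \<in> E \<Longrightarrow> (x, \<phi> x) \<in> P"
    by metis
  have graph: "\<phi> x = y" if "(x, y) \<in> P" for x y
    using elementary_functional[OF P L sep that] \<phi>[of x] that PE by blast
  have "x = x'" if "(x, y) \<in> P" "(x', y) \<in> P" for x x' y
    using elementary_functional[OF elementary_converse[OF P] L sep, of y x x'] that by simp
  then have inj: "inj_on \<phi> E"
    using \<phi> by (metis inj_onI)
  have "\<phi> ` E = E"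
  proof (intro equalityI subsetI)
    show "y \<in> E" if "y \<in> \<phi> ` E" for y
      using that \<phi> PE by blast
  next
    fix y assume "y \<in> E"
    with ran obtain x where x: "(x, y) \<in> P"
      by blast
    with PE have "x \<in> E"
      by blast
    with graph[OF x] show "y \<in> \<phi> ` E"
      by blast
  qed
  with inj have bij: "bij_betw \<phi> E E"
    by (simp add: bij_betw_def)
  then have \<phi>E: "\<phi> \<in> E \<rightarrow> E"
    by (auto simp: bij_betw_def)
  have "induced B E L E \<phi> = L"
  proof (rule cylinder_set_eqI)
    show "induced B E L E \<phi> \<subseteq> cylinders B E"
      by (auto simp: induced_def)
    show "L \<subseteq> cylinders B E"
      using L by (simp add: cyl_ultrafilter_def ultrafilter_in_def)
    fix es assume es: "set es \<subseteq> E"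
    then have "set (map (\<lambda>x. (x, \<phi> x)) es) \<subseteq> P"
      using \<phi> by auto
    from elementaryD[OF P this] have "tuple_type B E L es = tuple_type B E L (map \<phi> es)"
      by (simp add: comp_def)
    then show "tuple_type B E (induced B E L E \<phi>) es = tuple_type B E L es"
      using tuple_type_induced[OF \<phi>E es] by simp
  qed
  with bij graph that show thesis
    by (simp add: automorphism_def)
qed

text \<open>
  The relations \<open>P e\<close> are chosen by recursion along the cardinal well-order \<open>|E|\<close>. At stage \<open>e\<close> only
  \<open>2\<^sup>|\<^sup>B\<^sup>|\<close> many stages precede, because \<open>|E|\<close> is the successor of \<open>2\<^sup>|\<^sup>B\<^sup>|\<close>; the union of the earlier
  relations is therefore still small, and a further round is possible.
\<close>

lemma back_and_forth:
  fixes E :: "'e set"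
  assumes "infinite B" and reg: "regular_lim_rim B E L"
    and gch: "cardSuc |Pow B| =o |Pow (Pow B)|"
    and P0: "elementary B E L E L P0" "|P0| \<le>o |Pow B|"
  obtains \<phi> where "automorphism B E L \<phi>" "\<And>x y. (x, y) \<in> P0 \<Longrightarrow> \<phi> x = y"
proof -
  have sep: "separated B E L" and L: "cyl_ultrafilter B E L"
    and E_Pow: "|E| =o |Pow (Pow B)|"
    using reg by (simp_all add: regular_lim_rim_def lim_rim_def)
  have E: "|E| =o cardSuc |Pow B|"
    using E_Pow ordIso_transitive ordIso_symmetric gch by blast
  have inf: "infinite (Pow B)"
    using \<open>infinite B\<close> by simp
  let ?r = "|E| - Id"
  let ?below = "\<lambda>e. {d. (d, e) \<in> ?r}"
  have wo: "well_order_on E |E|"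
    by (rule card_of_well_order_on)
  then have wf: "wf ?r" and tot: "total_on E |E|"
    by (auto simp: well_order_on_def linear_order_on_def)
  have below_E: "?below e \<subseteq> E" for e
    using wo well_order_on_Field[OF wo] by (auto simp: Field_def)
  have below_card: "|?below e| \<le>o |Pow B|" if "e \<in> E" for e
  proof -
    have "e \<in> Field ( |E| )"
      using that by (simp only: Field_card_of)
    moreover have "?below e = underS ( |E| ) e"
      by (auto simp: underS_def)
    ultimately have "|?below e| <o |E|"
      using card_of_underS[OF card_of_Card_order, of e E] by simp
    then have "|?below e| <o cardSuc |Pow B|"
      using E ordLess_ordIso_trans by blast
    then show ?thesis
      using cardSuc_ordLeq_ordLess[OF card_of_Card_order card_of_Card_order] by blast
  qed
  define good where "good = (\<lambda>Q e Q'. elementary B E L E L Q' \<and> Q \<subseteq> Q' \<and> |Q'| \<le>o |Pow B| \<and>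
    e \<in> Domain Q' \<and> e \<in> Range Q')"
  define P where "P = wfrec ?r (\<lambda>p e. SOME Q'. good (P0 \<union> \<Union>(p ` ?below e)) e Q')"
  have P_rec: "P e = (SOME Q'. good (P0 \<union> \<Union>(P ` ?below e)) e Q')" for e
  proof -
    have "cut P ?r e ` ?below e = P ` ?below e"
      by (rule image_cong) (auto simp: cut_def)
    moreover have "P e = (SOME Q'. good (P0 \<union> \<Union>(cut P ?r e ` ?below e)) e Q')"
      unfolding P_def by (subst wfrec[OF wf]) simp
    ultimately show ?thesis
      by simp
  qed
  have good_chain: "P c \<subseteq> P d \<or> P d \<subseteq> P c"
    if cd: "c \<in> E" "d \<in> E" and good: "good (P0 \<union> \<Union>(P ` ?below c)) c (P c)"
      "good (P0 \<union> \<Union>(P ` ?below d)) d (P d)" for c d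
  proof -
    consider "c = d" | "c \<in> ?below d" | "d \<in> ?below c"
      using cd tot unfolding total_on_def by blast
    then show ?thesis
      using good unfolding good_def by cases blast+
  qed
  have P_good: "good (P0 \<union> \<Union>(P ` ?below e)) e (P e)" if "e \<in> E" for e
    using wf that
  proof (induction e rule: wf_induct_rule)
    case (less e)
    let ?C = "insert P0 (P ` ?below e)"
    have IH: "good (P0 \<union> \<Union>(P ` ?below d)) d (P d)" if "d \<in> ?below e" for d
      using less.IH[of d] that below_E by blast
    have chain: "P c \<subseteq> P d \<or> P d \<subseteq> P c" if "c \<in> ?below e" "d \<in> ?below e" for c d
    proof -
      have "c \<in> E" "d \<in> E"
        using that below_E by blast+
      then show ?thesis
        using good_chain IH that by blast
    qed
    have P0_le: "P0 \<subseteq> P d" if "d \<in> ?below e" for d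
      using IH[OF that] by (simp add: good_def)
    have "elementary B E L E L (\<Union>?C)"
    proof (rule elementary_Union)
      show "elementary B E L E L Q" if "Q \<in> ?C" for Q
        using that P0(1) IH by (auto simp: good_def)
      show "Q \<subseteq> Q' \<or> Q' \<subseteq> Q" if "Q \<in> ?C" "Q' \<in> ?C" for Q Q'
      proof -
        from that consider "Q = P0" "Q' = P0" | d where "d \<in> ?below e" "Q = P0" "Q' = P d"
          | c where "c \<in> ?below e" "Q = P c" "Q' = P0"
          | c d where "c \<in> ?below e" "d \<in> ?below e" "Q = P c" "Q' = P d"
          by blast
        then show ?thesis
          using P0_le chain by cases blast+
      qed
    qed simp
    moreover have "|\<Union>?C| \<le>o |Pow B|"
    proof -
      have "|\<Union>(P ` ?below e)| \<le>o |Pow B|"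
      proof (rule card_of_UNION_ordLeq_infinite[OF inf below_card[OF less.prems]])
        show "\<forall>d\<in>?below e. |P d| \<le>o |Pow B|"
          using IH by (auto simp: good_def)
      qed
      then show ?thesis
        using Un_ordLeq_infinite[OF inf P0(2)] by simp
    qed
    ultimately have "\<exists>Q'. good (\<Union>?C) e Q'"
      using elementary_step_both[OF \<open>infinite B\<close> reg _ _ less.prems] unfolding good_def by blast
    then have "good (\<Union>?C) e (SOME Q'. good (\<Union>?C) e Q')"
      by (rule someI_ex)
    then show ?case
      by (subst P_rec) simp
  qed
  have P0_le: "P0 \<subseteq> P e" if "e \<in> E" for e
    using P_good[OF that] by (simp add: good_def)
  have chain: "P c \<subseteq> P d \<or> P d \<subseteq> P c" if "c \<in> E" "d \<in> E" for c d
    using good_chain[OF that] P_good that by blast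
  have "E \<noteq> {}"
    using card_of_ordIso_finite[OF E_Pow] \<open>infinite B\<close> by auto
  let ?P = "\<Union>(P ` E)"
  have "elementary B E L E L ?P"
  proof (rule elementary_Union)
    show "elementary B E L E L Q" if "Q \<in> P ` E" for Q
      using that P_good by (auto simp: good_def)
    show "Q \<subseteq> Q' \<or> Q' \<subseteq> Q" if "Q \<in> P ` E" "Q' \<in> P ` E" for Q Q'
      using that chain by blast
    show "P ` E \<noteq> {}"
      using \<open>E \<noteq> {}\<close> by simp
  qed
  moreover have "E \<subseteq> Domain ?P" "E \<subseteq> Range ?P"
    using P_good unfolding good_def by blast+
  ultimately obtain \<phi> where \<phi>: "automorphism B E L \<phi>" "\<And>x y. (x, y) \<in> ?P \<Longrightarrow> \<phi> x = y"
    using automorphism_of_elementary[OF L sep] by blast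
  have "P0 \<subseteq> ?P"
    using P0_le \<open>E \<noteq> {}\<close> by blast
  then show thesis
    using that[OF \<phi>(1)] \<phi>(2) by (meson subsetD)
qed

section \<open>Embeddings over an injection of bases\<close>

lemma star_iff_tuple_type:
  "es \<in> tuples n E \<Longrightarrow> es \<in> star B E L n R \<longleftrightarrow> R \<in> tuple_type B E L es"
  by (simp add: star_def tuple_type_def)

lemma embedding_over_base_change:
  assumes L1: "cyl_ultrafilter B1 E1 L1" and sep: "separated B1 E1 L1"
    and L: "cyl_ultrafilter B E L" and j: "inj_on j B1" "j \<in> B1 \<rightarrow> B" and f: "f \<in> E1 \<rightarrow> E"
    and tt: "\<And>es. set es \<subseteq> E1 \<Longrightarrow>
      tuple_type B E1 (base_change j B1 B E1 L1) es = tuple_type B E L (map f es)"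
  shows "embedding_over j B1 E1 L1 B E L f"
proof -
  have transfer: "S \<in> tuple_type B E L (map f es) \<longleftrightarrow> R \<in> tuple_type B1 E1 L1 es"
    if es: "set es \<subseteq> E1"
      and S: "\<And>\<psi>. \<psi> \<in> E1 \<rightarrow>\<^sub>E B1 \<Longrightarrow> map j (map \<psi> es) \<in> S \<longleftrightarrow> map \<psi> es \<in> R" for es R S
  proof -
    have "{\<psi> \<in> E1 \<rightarrow>\<^sub>E B1. map \<psi> es \<in> {xs. map j xs \<in> S}} = {\<psi> \<in> E1 \<rightarrow>\<^sub>E B1. map \<psi> es \<in> R}"
      using S by blast
    then have "{xs. map j xs \<in> S} \<in> tuple_type B1 E1 L1 es \<longleftrightarrow> R \<in> tuple_type B1 E1 L1 es"
      by (simp add: tuple_type_def)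
    then show ?thesis
      using tuple_type_base_change[OF j(2) es, of S L1] tt[OF es] by simp
  qed
  have "inj_on f E1"
  proof (rule inj_onI)
    fix x y assume xy: "x \<in> E1" "y \<in> E1" "f x = f y"
    have "diagonal \<in> tuple_type B E L (map f [x, y])"
      using xy(3) by (intro tuple_type_total[OF L]) (simp add: diagonal_def)
    moreover have "map j (map \<psi> [x, y]) \<in> diagonal \<longleftrightarrow> map \<psi> [x, y] \<in> diagonal"
      if "\<psi> \<in> E1 \<rightarrow>\<^sub>E B1" for \<psi>
      using that xy j(1) by (auto simp: diagonal_def inj_on_def PiE_iff)
    ultimately have "diagonal \<in> tuple_type B1 E1 L1 [x, y]"
      using transfer[of "[x, y]" diagonal diagonal] xy by simp
    then show "x = y"
      by (rule separatedD[OF sep xy(1,2)])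
  qed
  moreover have "es \<in> star B1 E1 L1 n R \<longleftrightarrow> map f es \<in> star B E L n (map j ` R)"
    if R: "R \<subseteq> tuples n B1" and es: "es \<in> tuples n E1" for n R es
  proof -
    have set_es: "set es \<subseteq> E1"
      using es by (simp add: tuples_def)
    have "map f es \<in> tuples n E"
      using es f by (auto simp: tuples_def)
    moreover have "map j (map \<psi> es) \<in> map j ` R \<longleftrightarrow> map \<psi> es \<in> R" if "\<psi> \<in> E1 \<rightarrow>\<^sub>E B1" for \<psi>
    proof
      assume "map j (map \<psi> es) \<in> map j ` R"
      then obtain ys where ys: "ys \<in> R" "map j (map \<psi> es) = map j ys"
        by blast
      have "set (map \<psi> es) \<union> set ys \<subseteq> B1"
        using that set_es ys(1) R by (auto simp: tuples_def)
      then have "map \<psi> es = ys"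
        using map_inj_on[OF ys(2)] j(1) inj_on_subset by blast
      with ys(1) show "map \<psi> es \<in> R"
        by simp
    qed blast
    ultimately show ?thesis
      using transfer[OF set_es, of "map j ` R" R] es by (simp add: star_iff_tuple_type)
  qed
  ultimately show ?thesis
    using f by (simp add: embedding_over_def)
qed

text \<open>
  An embedding over \<open>j\<close> speaks only of relations of the form \<open>j(R)\<close>. It nevertheless determines the
  whole type of an image tuple: the full relation on \<open>B1\<close> shows that the type contains
  \<open>j(B1\<^sup>n)\<close>, so \<open>S\<close> can be replaced by its intersection with \<open>j(B1\<^sup>n)\<close>, which is of this form.
\<close>

lemma tuple_type_embedding:
  assumes L1: "cyl_ultrafilter B1 E1 L1" and L: "cyl_ultrafilter B E L"
    and f: "embedding_over j B1 E1 L1 B E L f" and es: "set es \<subseteq> E1"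
  shows "S \<in> tuple_type B E L (map f es) \<longleftrightarrow>
    {xs \<in> tuples (length es) B1. map j xs \<in> S} \<in> tuple_type B1 E1 L1 es"
proof -
  let ?n = "length es"
  have fE: "f \<in> E1 \<rightarrow> E"
    using f by (simp add: embedding_over_def)
  have tup: "es \<in> tuples ?n E1" "map f es \<in> tuples ?n E" and fes: "set (map f es) \<subseteq> E"
    using es fE by (auto simp: tuples_def)
  have transfer: "R \<in> tuple_type B1 E1 L1 es \<longleftrightarrow> map j ` R \<in> tuple_type B E L (map f es)"
    if "R \<subseteq> tuples ?n B1" for R
  proof -
    have "es \<in> star B1 E1 L1 ?n R \<longleftrightarrow> map f es \<in> star B E L ?n (map j ` R)"
      using f that tup(1) unfolding embedding_over_def by blast
    then show ?thesis
      by (simp only: star_iff_tuple_type[OF tup(1)] star_iff_tuple_type[OF tup(2)])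
  qed
  have "tuples ?n B1 \<in> tuple_type B1 E1 L1 es"
    using es by (intro tuple_type_total[OF L1]) (auto simp: tuples_def)
  then have "map j ` tuples ?n B1 \<in> tuple_type B E L (map f es)"
    using transfer[of "tuples ?n B1"] by simp
  moreover have "map j ` tuples ?n B1 \<inter> S = map j ` {xs \<in> tuples ?n B1. map j xs \<in> S}"
    by blast
  ultimately have "S \<in> tuple_type B E L (map f es) \<longleftrightarrow>
      map j ` {xs \<in> tuples ?n B1. map j xs \<in> S} \<in> tuple_type B E L (map f es)"
    using tuple_type_Int[OF L fes, of "map j ` tuples ?n B1" S] by (simp only:)
  then show ?thesis
    using transfer[of "{xs \<in> tuples ?n B1. map j xs \<in> S}"] by blast
qed

theorem mainTheorem7:
  fixes B1 :: "'b1 set" and B :: "'b set" and j :: "'b1 \<Rightarrow> 'b"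
    and E1 :: "'e1 set" and L1 :: "('e1 \<Rightarrow> 'b1) set set"
    and E :: "'e set" and L :: "('e \<Rightarrow> 'b) set set"
  assumes "infinite B1" and "infinite B"
    and "|Pow B1| \<le>o |B|"
    and "inj_on j B1" and "j \<in> B1 \<rightarrow> B"
    and "regular_lim_rim B1 E1 L1"
    and "regular_lim_rim B E L"
  shows "(\<exists>f. embedding_over j B1 E1 L1 B E L f) \<and>
    (cardSuc |Pow B| =o |Pow (Pow B)| \<longrightarrow>
      (\<forall>f g. embedding_over j B1 E1 L1 B E L f \<and> embedding_over j B1 E1 L1 B E L g \<longrightarrow>
        (\<exists>\<phi>. automorphism B E L \<phi> \<and> (\<forall>e\<in>E1. \<phi> (f e) = g e))))"
proof (intro conjI impI allI)
  have L1: "cyl_ultrafilter B1 E1 L1" "separated B1 E1 L1"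
    and L: "cyl_ultrafilter B E L" "separated B E L" "exact (cardSuc |Pow B| ) B E L"
    using assms(6,7) by (auto simp: regular_lim_rim_def lim_rim_def)
  have "|Pow (Pow B1)| \<le>o |Pow B|"
  proof -
    obtain h where h: "inj_on h (Pow B1)" "h ` Pow B1 \<subseteq> B"
      using assms(3) card_of_ordLeq by metis
    have "inj_on (image h) (Pow (Pow B1))"
      by (rule inj_on_image_Pow[OF h(1)])
    moreover have "image h ` Pow (Pow B1) \<subseteq> Pow B"
      using h(2) by auto
    ultimately show ?thesis
      using card_of_ordLeq by metis
  qed
  moreover have "|E1| =o |Pow (Pow B1)|"
    using assms(6) by (simp add: regular_lim_rim_def)
  ultimately have E1: "|E1| \<le>o |Pow B|"
    using ordIso_ordLeq_trans by blast
  show "\<exists>f. embedding_over j B1 E1 L1 B E L f"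
  proof -
    have "cyl_ultrafilter B E1 (base_change j B1 B E1 L1)"
      by (rule cyl_ultrafilter_base_change[OF L1(1) assms(5)])
    then obtain f where "f \<in> E1 \<rightarrow> E" "\<And>es. set es \<subseteq> E1 \<Longrightarrow>
        tuple_type B E1 (base_change j B1 B E1 L1) es = tuple_type B E L (map f es)"
      using elementary_total_map[OF assms(2) _ L E1] by blast
    then show ?thesis
      using embedding_over_base_change[OF L1 L(1) assms(4,5)] by blast
  qed
  fix f g
  assume gch: "cardSuc |Pow B| =o |Pow (Pow B)|"
    and fg: "embedding_over j B1 E1 L1 B E L f \<and> embedding_over j B1 E1 L1 B E L g"
  then have f: "embedding_over j B1 E1 L1 B E L f" and g: "embedding_over j B1 E1 L1 B E L g"
    by simp_all
  let ?P = "(\<lambda>x. (f x, g x)) ` E1"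
  have "elementary B E L E L ?P"
    unfolding elementary_def
  proof (intro conjI allI impI)
    show "?P \<subseteq> E \<times> E"
      using f g by (auto simp: embedding_over_def)
    fix ps assume "set ps \<subseteq> ?P"
    then have "ps \<in> lists ?P"
      by (simp only: in_listsI subset_iff Ball_def)
    then have "ps \<in> map (\<lambda>x. (f x, g x)) ` lists E1"
      by (simp only: lists_image)
    then obtain es where es: "set es \<subseteq> E1" and ps: "ps = map (\<lambda>x. (f x, g x)) es"
      by auto
    have "tuple_type B E L (map f es) = tuple_type B E L (map g es)"
      using tuple_type_embedding[OF L1(1) L(1) f es] tuple_type_embedding[OF L1(1) L(1) g es]
      by blast
    then show "tuple_type B E L (map fst ps) = tuple_type B E L (map snd ps)"
      by (simp add: ps comp_def)
  qed
  moreover have "|?P| \<le>o |Pow B|"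
    using card_of_image[of _ E1] E1 ordLeq_transitive by blast
  ultimately obtain \<phi> where "automorphism B E L \<phi>" "\<And>x y. (x, y) \<in> ?P \<Longrightarrow> \<phi> x = y"
    using back_and_forth[OF assms(2,7) gch] by blast
  then show "\<exists>\<phi>. automorphism B E L \<phi> \<and> (\<forall>e\<in>E1. \<phi> (f e) = g e)"
    by blast
qed

end
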